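(* Let $0 \leq k \leq n$ be integers and let $m=\min(k,n-k)$. Then $$2^{2^{m+o(1)}} \leq G(n,k) \leq 2^{2^{2m+O\left(\log_2 m\right)}},$$ where the $o(1)$ and $O(\log_2 m)$ terms are quantities depending only on $m$, with $o(1)\to 0$ as $m\to\infty$ and $O(\log_2 m)$ bounded in absolute value by a constant times $\log_2 m$ for all sufficiently large $m$ (uniformly in $n$).
   Context: $Q_n$ is the $n$-dimensional Boolean hypercube with vertex set $\{-1,1\}^n$, two vertices being adjacent iff they differ in exactly one coordinate; $\Gamma(x)$ denotes the neighbourhood of $x$. A Boolean function on $Q_n$ is a function $f:\{-1,1\}^n\to\{-1,1\}$. A $k$-function is a Boolean function $f$ on $Q_n$ such that for every vertex $v$, $|\{w\in\Gamma(v): f(v)\neq f(w)\}|=k$. Two real-valued functions $f,g$ on $Q_n$ are isomorphic if there is a graph automorphism $\phi$ of $Q_n$ and a sign $\epsilon\in\{-1,1\}$ with $f=\epsilon\, g\circ\phi$. $G(n,k)$ denotes the number of isomorphism classes of $k$-functions on $Q_n$.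
   Formalization: The lower bound is stated only for m ≥ 2: for m = 0 and m = 1 there is exactly one isomorphism class, G(n,k) = 1, whereas 2^{2^x} > 1 for every real x, so no real-valued o(1) term can work there; the upper bound is stated for all 0 ≤ k ≤ n. *)

theory Defs
  imports "HOL-Analysis.Analysis" "HOL-Library.Landau_Symbols"
begin

text \<open>
  The hypercube is a family of explicit carriers, since the dimension is quantified inside the
  statement. Vertices, and functions on the vertices, are extensional, so that equality of such
  objects is equality on the carrier and cardinalities are the intended ones.
\<close>

definition cube :: "nat \<Rightarrow> (nat \<Rightarrow> real) set" where
  "cube n = {..<n} \<rightarrow>\<^sub>E {-1, 1}"

definition cube_adj :: "nat \<Rightarrow> (nat \<Rightarrow> real) \<Rightarrow> (nat \<Rightarrow> real) \<Rightarrow> bool" where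
  "cube_adj n x y \<longleftrightarrow> x \<in> cube n \<and> y \<in> cube n \<and> card {i \<in> {..<n}. x i \<noteq> y i} = 1"

definition nbhd :: "nat \<Rightarrow> (nat \<Rightarrow> real) \<Rightarrow> (nat \<Rightarrow> real) set" where
  "nbhd n x = {y. cube_adj n x y}"

definition boolean_functions :: "nat \<Rightarrow> ((nat \<Rightarrow> real) \<Rightarrow> real) set" where
  "boolean_functions n = cube n \<rightarrow>\<^sub>E {-1, 1}"

definition k_functions :: "nat \<Rightarrow> nat \<Rightarrow> ((nat \<Rightarrow> real) \<Rightarrow> real) set" where
  "k_functions n k =
     {f \<in> boolean_functions n. \<forall>v \<in> cube n. card {w \<in> nbhd n v. f v \<noteq> f w} = k}"

definition cube_automorphism :: "nat \<Rightarrow> ((nat \<Rightarrow> real) \<Rightarrow> (nat \<Rightarrow> real)) \<Rightarrow> bool" where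
  "cube_automorphism n \<phi> \<longleftrightarrow>
     bij_betw \<phi> (cube n) (cube n) \<and>
     (\<forall>x \<in> cube n. \<forall>y \<in> cube n. cube_adj n (\<phi> x) (\<phi> y) \<longleftrightarrow> cube_adj n x y)"

definition cube_isomorphic ::
  "nat \<Rightarrow> ((nat \<Rightarrow> real) \<Rightarrow> real) \<Rightarrow> ((nat \<Rightarrow> real) \<Rightarrow> real) \<Rightarrow> bool" where
  "cube_isomorphic n f g \<longleftrightarrow>
     (\<exists>\<phi> \<epsilon>. cube_automorphism n \<phi> \<and> \<epsilon> \<in> {-1, 1} \<and> (\<forall>x \<in> cube n. f x = \<epsilon> * g (\<phi> x)))"

definition iso_rel ::
  "nat \<Rightarrow> nat \<Rightarrow> (((nat \<Rightarrow> real) \<Rightarrow> real) \<times> ((nat \<Rightarrow> real) \<Rightarrow> real)) set" where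
  "iso_rel n k =
     {(f, g). f \<in> k_functions n k \<and> g \<in> k_functions n k \<and> cube_isomorphic n f g}"

definition G :: "nat \<Rightarrow> nat \<Rightarrow> nat" where
  "G n k = card (k_functions n k // iso_rel n k)"

lemma finite_cube: "finite (cube n)"
  unfolding cube_def by (intro finite_PiE) auto

lemma finite_k_functions: "finite (k_functions n k)"
proof (rule finite_subset)
  show "k_functions n k \<subseteq> boolean_functions n"
    unfolding k_functions_def by blast
  show "finite (boolean_functions n)"
    unfolding boolean_functions_def by (intro finite_PiE finite_cube) auto
qed

lemma cube_isomorphic_refl: "cube_isomorphic n f f"
  unfolding cube_isomorphic_def cube_automorphism_def
  by (intro exI[of _ "\<lambda>x. x"] exI[of _ 1]) (auto simp: bij_betw_def inj_on_def)

lemma cube_isomorphic_sym: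
  assumes "cube_isomorphic n f g"
  shows "cube_isomorphic n g f"
proof -
  obtain \<phi> \<epsilon> where b: "bij_betw \<phi> (cube n) (cube n)"
    and a: "\<And>x y. x \<in> cube n \<Longrightarrow> y \<in> cube n \<Longrightarrow> cube_adj n (\<phi> x) (\<phi> y) \<longleftrightarrow> cube_adj n x y"
    and e: "\<epsilon> \<in> {-1, 1}" and f: "\<And>x. x \<in> cube n \<Longrightarrow> f x = \<epsilon> * g (\<phi> x)"
    using assms unfolding cube_isomorphic_def cube_automorphism_def by blast
  define \<psi> where "\<psi> = inv_into (cube n) \<phi>"
  have bp: "bij_betw \<psi> (cube n) (cube n)"
    unfolding \<psi>_def using b by (rule bij_betw_inv_into)
  have inC: "\<psi> x \<in> cube n" if "x \<in> cube n" for x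
    using bp that by (rule bij_betw_apply)
  have inv: "\<phi> (\<psi> x) = x" if "x \<in> cube n" for x
    unfolding \<psi>_def using b that by (rule bij_betw_inv_into_right)
  have "cube_adj n (\<psi> x) (\<psi> y) \<longleftrightarrow> cube_adj n x y" if "x \<in> cube n" "y \<in> cube n" for x y
    using a[OF inC[OF that(1)] inC[OF that(2)]] inv that by simp
  moreover have "g x = \<epsilon> * f (\<psi> x)" if "x \<in> cube n" for x
    using f[OF inC[OF that]] inv[OF that] e by auto
  ultimately show ?thesis
    unfolding cube_isomorphic_def cube_automorphism_def using bp e by blast
qed

lemma cube_isomorphic_trans:
  assumes "cube_isomorphic n f g" and "cube_isomorphic n g h"
  shows "cube_isomorphic n f h"
proof -
  obtain \<phi> \<epsilon> where p: "cube_automorphism n \<phi>" "\<epsilon> \<in> {-1, 1}"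
    "\<And>x. x \<in> cube n \<Longrightarrow> f x = \<epsilon> * g (\<phi> x)"
    using assms(1) unfolding cube_isomorphic_def by blast
  obtain \<psi> \<delta> where q: "cube_automorphism n \<psi>" "\<delta> \<in> {-1, 1}"
    "\<And>x. x \<in> cube n \<Longrightarrow> g x = \<delta> * h (\<psi> x)"
    using assms(2) unfolding cube_isomorphic_def by blast
  have inC: "\<phi> x \<in> cube n" if "x \<in> cube n" for x
    using p(1) that unfolding cube_automorphism_def by (auto dest: bij_betw_apply)
  have "cube_automorphism n (\<psi> \<circ> \<phi>)"
    using p(1) q(1) inC unfolding cube_automorphism_def
    by (auto intro: bij_betw_trans)
  moreover have "\<epsilon> * \<delta> \<in> {-1, 1}"
    using p(2) q(2) by auto
  moreover have "f x = \<epsilon> * \<delta> * h ((\<psi> \<circ> \<phi>) x)" if "x \<in> cube n" for x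
    using p(3)[OF that] q(3)[OF inC[OF that]] by simp
  ultimately show ?thesis
    unfolding cube_isomorphic_def by blast
qed

lemma equiv_iso_rel: "equiv (k_functions n k) (iso_rel n k)"
  by (rule equivI)
    (auto simp: iso_rel_def refl_on_def sym_def trans_def
      intro: cube_isomorphic_refl cube_isomorphic_sym cube_isomorphic_trans)

end

theory Submission
  imports Defs "HOL-Real_Asymp.Real_Asymp"
begin

text \<open>
  A \<open>k\<close>-function is an eigenfunction of the hypercube, so its Walsh expansion is homogeneous of
  degree \<open>k\<close>. Multiplication by the full parity character exchanges \<open>k\<close>-functions and
  \<open>(n - k)\<close>-functions and respects isomorphism, so one may assume \<open>k = m\<close>.

  Upper bound: the Walsh coefficients of a \<open>k\<close>-function are multiples of \<open>2\<^sup>-\<^sup>k\<close> whose squares add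
  up to \<open>1\<close>, so at most \<open>4\<^sup>k\<close> of them are nonzero, and at most \<open>k 4\<^sup>k\<close> coordinates occur. After a
  permutation of the coordinates these are the first ones, and the expansions can be counted.

  Lower bound: for a family \<open>F\<close> of subsets of \<open>{0..<k}\<close>, the product \<open>x\<^sub>0 \<dots> x\<^sub>k\<^sub>-\<^sub>1\<close>, with its sign
  changed unless \<open>{i. x\<^sub>i = x\<^sub>k\<^sub>+\<^sub>i} \<in> F\<close>, is a \<open>k\<close>-function. There are \<open>2 ^ 2 ^ k\<close> of these. The
  coordinates of an automorphism are \<open>1\<close>-functions, hence signed coordinates, and therefore an
  isomorphism class contains only \<open>2 ^ O(k log k)\<close> of them, uniformly in \<open>n\<close>.
\<close>

section \<open>The cube and its automorphisms\<close>

definition flip :: "nat \<Rightarrow> (nat \<Rightarrow> real) \<Rightarrow> nat \<Rightarrow> real" where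
  "flip i x = x(i := - x i)"

definition sign_vec :: "nat \<Rightarrow> nat set \<Rightarrow> nat \<Rightarrow> real" where
  "sign_vec n A = (\<lambda>i\<in>{..<n}. if i \<in> A then -1 else 1)"

definition walsh :: "nat \<Rightarrow> nat set \<Rightarrow> (nat \<Rightarrow> real) \<Rightarrow> real" where
  "walsh n S = (\<lambda>x\<in>cube n. prod x S)"

lemma cube_cases: "x \<in> cube n \<Longrightarrow> i < n \<Longrightarrow> x i = -1 \<or> x i = 1"
  unfolding cube_def by auto

lemma cube_mult_self: "x \<in> cube n \<Longrightarrow> i < n \<Longrightarrow> x i * x i = 1"
  using cube_cases by fastforce

lemma cube_eqI: "x \<in> cube n \<Longrightarrow> y \<in> cube n \<Longrightarrow> (\<And>i. i < n \<Longrightarrow> x i = y i) \<Longrightarrow> x = y"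
  unfolding cube_def by (metis PiE_ext lessThan_iff)

lemma card_cube: "card (cube n) = 2 ^ n"
  unfolding cube_def by (simp add: card_PiE numeral_2_eq_2)

lemma sign_vec_in_cube: "sign_vec n A \<in> cube n"
  unfolding sign_vec_def cube_def by auto

lemma flip_in_cube: "x \<in> cube n \<Longrightarrow> i < n \<Longrightarrow> flip i x \<in> cube n"
  unfolding flip_def cube_def by (auto simp: PiE_iff extensional_def)

lemma flip_flip [simp]: "flip i (flip i x) = x"
  unfolding flip_def by auto

lemma flip_same [simp]: "flip i x i = - x i"
  unfolding flip_def by simp

lemma flip_other: "j \<noteq> i \<Longrightarrow> flip i x j = x j"
  unfolding flip_def by simp

lemma bij_betw_flip: "i < n \<Longrightarrow> bij_betw (flip i) (cube n) (cube n)"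
  by (rule bij_betwI[where g = "flip i"]) (auto simp: flip_in_cube)

lemma prod_flip:
  assumes "finite S"
  shows "prod (flip i x) S = (if i \<in> S then - prod x S else prod x S)"
proof (cases "i \<in> S")
  case True
  have "prod (flip i x) (S - {i}) = prod x (S - {i})"
    by (rule prod.cong) (auto simp: flip_other)
  then show ?thesis
    using True assms by (simp add: prod.remove[of S i])
next
  case False
  then have "prod (flip i x) S = prod x S"
    by (intro prod.cong) (auto simp: flip_def)
  then show ?thesis using False by simp
qed

lemma prod_cube_cases:
  assumes "x \<in> cube n" "S \<subseteq> {..<n}"
  shows "prod x S = -1 \<or> prod x S = 1"
proof -
  have "finite S" using assms(2) finite_subset by blast
  then show ?thesis
    using assms(2)
  proof (induction S)
    case (insert i S)
    then show ?case using cube_cases[OF assms(1), of i] by auto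
  qed auto
qed

section \<open>Adjacency and sensitivity in terms of coordinate flips\<close>

lemma cube_adj_iff_flip:
  assumes "x \<in> cube n"
  shows "cube_adj n x y \<longleftrightarrow> (\<exists>i<n. y = flip i x)"
proof
  assume "cube_adj n x y"
  then have y: "y \<in> cube n" and c: "card {i \<in> {..<n}. x i \<noteq> y i} = 1"
    unfolding cube_adj_def by auto
  from c obtain i where i: "{i \<in> {..<n}. x i \<noteq> y i} = {i}"
    using card_1_singletonE by blast
  then have "i \<in> {i \<in> {..<n}. x i \<noteq> y i}" by simp
  then have "i < n" "x i \<noteq> y i" by auto
  have "y j = flip i x j" if "j < n" for j
  proof (cases "j = i")
    case True
    then show ?thesis
      using cube_cases[OF assms \<open>i < n\<close>] cube_cases[OF y \<open>i < n\<close>] \<open>x i \<noteq> y i\<close> by auto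
  next
    case False
    then have "j \<notin> {i \<in> {..<n}. x i \<noteq> y i}" unfolding i by simp
    then show ?thesis using that False by (simp add: flip_other)
  qed
  then show "\<exists>i<n. y = flip i x"
    using cube_eqI[OF y flip_in_cube[OF assms \<open>i < n\<close>]] \<open>i < n\<close> by blast
next
  assume "\<exists>i<n. y = flip i x"
  then obtain i where i: "i < n" "y = flip i x" by blast
  have "{j \<in> {..<n}. x j \<noteq> y j} = {i}"
    using i cube_cases[OF assms, of i] by (auto simp: flip_def)
  then show "cube_adj n x y"
    using i assms flip_in_cube unfolding cube_adj_def by auto
qed

lemma nbhd_eq: "x \<in> cube n \<Longrightarrow> nbhd n x = (\<lambda>i. flip i x) ` {..<n}"
  unfolding nbhd_def by (auto simp: cube_adj_iff_flip)

text \<open>No entry of a vertex equals its own negative, so distinct coordinates give distinct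
  neighbours and counting neighbours is counting coordinates.\<close>

lemma card_sensitive_neighbours:
  assumes "x \<in> cube n"
  shows "card {w \<in> nbhd n x. f x \<noteq> f w} = card {i \<in> {..<n}. f x \<noteq> f (flip i x)}"
proof -
  have "inj_on (\<lambda>i. flip i x) {..<n}"
  proof (rule inj_onI)
    fix i j assume ij: "i \<in> {..<n}" "j \<in> {..<n}" "flip i x = flip j x"
    show "i = j"
    proof (rule ccontr)
      assume "i \<noteq> j"
      then have "- x i = x i" using ij(3) by (metis flip_same flip_other)
      then show False using cube_cases[OF assms, of i] ij by auto
    qed
  qed
  then have "inj_on (\<lambda>i. flip i x) {i \<in> {..<n}. f x \<noteq> f (flip i x)}"
    by (rule inj_on_subset) auto
  moreover have "{w \<in> nbhd n x. f x \<noteq> f w} = (\<lambda>i. flip i x) ` {i \<in> {..<n}. f x \<noteq> f (flip i x)}"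
    by (auto simp: nbhd_eq[OF assms])
  ultimately show ?thesis by (simp add: card_image)
qed

lemma k_functions_iff:
  "f \<in> k_functions n k \<longleftrightarrow> f \<in> boolean_functions n \<and>
     (\<forall>x\<in>cube n. card {i \<in> {..<n}. f x \<noteq> f (flip i x)} = k)"
  unfolding k_functions_def by (auto simp: card_sensitive_neighbours)

lemma boolean_cases: "f \<in> boolean_functions n \<Longrightarrow> x \<in> cube n \<Longrightarrow> f x = -1 \<or> f x = 1"
  unfolding boolean_functions_def by auto

lemma k_function_cases: "f \<in> k_functions n k \<Longrightarrow> x \<in> cube n \<Longrightarrow> f x = -1 \<or> f x = 1"
  unfolding k_functions_def using boolean_cases by auto

text \<open>Flipping coordinate \<open>i\<close> negates the character exactly when
  \<open>i \<in> S\<close>, so at every vertex the sensitive coordinates are those of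
  \<open>S\<close>.\<close>

lemma walsh_k_function:
  assumes "S \<subseteq> {..<n}"
  shows "walsh n S \<in> k_functions n (card S)"
proof -
  have fin: "finite S" using assms finite_subset by blast
  have "walsh n S \<in> boolean_functions n"
    unfolding walsh_def boolean_functions_def using prod_cube_cases[OF _ assms] by auto
  moreover have "{i \<in> {..<n}. walsh n S x \<noteq> walsh n S (flip i x)} = S" if "x \<in> cube n" for x
    using that assms prod_cube_cases[OF that assms]
    by (auto simp: walsh_def flip_in_cube prod_flip[OF fin])
  ultimately show ?thesis unfolding k_functions_iff by auto
qed

section \<open>Automorphisms acting on vertices and on functions\<close>

lemma automorphism_in_cube: "cube_automorphism n \<phi> \<Longrightarrow> x \<in> cube n \<Longrightarrow> \<phi> x \<in> cube n"
  unfolding cube_automorphism_def by (auto dest: bij_betw_apply)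

lemma automorphism_nbhd:
  assumes "cube_automorphism n \<phi>" "x \<in> cube n"
  shows "\<phi> ` nbhd n x = nbhd n (\<phi> x)"
proof -
  have b: "bij_betw \<phi> (cube n) (cube n)"
    and a: "\<And>x y. x \<in> cube n \<Longrightarrow> y \<in> cube n \<Longrightarrow> cube_adj n (\<phi> x) (\<phi> y) \<longleftrightarrow> cube_adj n x y"
    using assms(1) unfolding cube_automorphism_def by auto
  show ?thesis
  proof
    show "\<phi> ` nbhd n x \<subseteq> nbhd n (\<phi> x)"
      using a assms unfolding nbhd_def by (auto simp: cube_adj_def)
    show "nbhd n (\<phi> x) \<subseteq> \<phi> ` nbhd n x"
    proof
      fix w assume "w \<in> nbhd n (\<phi> x)"
      then have w: "cube_adj n (\<phi> x) w" "w \<in> cube n"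
        unfolding nbhd_def by (auto simp: cube_adj_def)
      then obtain y where "y \<in> cube n" "w = \<phi> y"
        using b unfolding bij_betw_def by auto
      then show "w \<in> \<phi> ` nbhd n x" using w a assms unfolding nbhd_def by auto
    qed
  qed
qed

text \<open>An automorphism maps the neighbourhood of \<open>x\<close> bijectively onto that of its
  image and carries sensitive neighbours to sensitive neighbours.\<close>

lemma k_functions_automorphism:
  assumes "cube_automorphism n \<phi>" "f \<in> k_functions n k"
  shows "(\<lambda>x\<in>cube n. f (\<phi> x)) \<in> k_functions n k"
proof -
  let ?h = "\<lambda>x\<in>cube n. f (\<phi> x)"
  have "?h \<in> boolean_functions n"
    using assms automorphism_in_cube[OF assms(1)]
    unfolding boolean_functions_def k_functions_def by auto
  moreover have "card {w \<in> nbhd n x. ?h x \<noteq> ?h w} = k" if x: "x \<in> cube n" for x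
  proof -
    have sub: "nbhd n x \<subseteq> cube n" unfolding nbhd_def cube_adj_def by auto
    have "inj_on \<phi> (cube n)"
      using assms(1) unfolding cube_automorphism_def bij_betw_def by auto
    then have "inj_on \<phi> {w \<in> nbhd n x. ?h x \<noteq> ?h w}"
      by (rule inj_on_subset) (use sub in auto)
    moreover have "\<phi> ` {w \<in> nbhd n x. ?h x \<noteq> ?h w} = {w \<in> nbhd n (\<phi> x). f (\<phi> x) \<noteq> f w}"
      unfolding automorphism_nbhd[OF assms(1) x, symmetric] using sub x by auto
    ultimately have "card {w \<in> nbhd n x. ?h x \<noteq> ?h w} = card {w \<in> nbhd n (\<phi> x). f (\<phi> x) \<noteq> f w}"
      by (metis (no_types, lifting) card_image)
    then show ?thesis
      using assms(2) automorphism_in_cube[OF assms(1) x] unfolding k_functions_def by auto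
  qed
  ultimately show ?thesis unfolding k_functions_def by auto
qed

lemma permutation_automorphism:
  assumes "bij_betw \<pi> {..<n} {..<n}"
  shows "cube_automorphism n (\<lambda>x. \<lambda>i\<in>{..<n}. x (\<pi> i))"
proof -
  let ?P = "\<lambda>\<pi> x. \<lambda>i\<in>{..<n}. (x (\<pi> i) :: real)"
  define \<rho> where "\<rho> = inv_into {..<n} \<pi>"
  have r: "bij_betw \<rho> {..<n} {..<n}"
    unfolding \<rho>_def using assms by (rule bij_betw_inv_into)
  have in1: "\<pi> i < n" if "i < n" for i using bij_betw_apply[OF assms, of i] that by auto
  have in2: "\<rho> i < n" if "i < n" for i using bij_betw_apply[OF r, of i] that by auto
  have pr: "\<pi> (\<rho> i) = i" if "i < n" for i
    unfolding \<rho>_def using bij_betw_inv_into_right[OF assms, of i] that by auto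
  have rp: "\<rho> (\<pi> i) = i" if "i < n" for i
    unfolding \<rho>_def using bij_betw_inv_into_left[OF assms, of i] that by auto
  have c1: "?P \<pi> x \<in> cube n" if "x \<in> cube n" for x
    using that in1 unfolding cube_def by (auto simp: PiE_iff)
  have c2: "?P \<rho> x \<in> cube n" if "x \<in> cube n" for x
    using that in2 unfolding cube_def by (auto simp: PiE_iff)
  have "bij_betw (?P \<pi>) (cube n) (cube n)"
  proof (rule bij_betwI[where g = "?P \<rho>"])
    show "?P \<rho> (?P \<pi> x) = x" if "x \<in> cube n" for x
      by (rule cube_eqI[OF c2[OF c1[OF that]] that]) (simp add: in2 pr)
    show "?P \<pi> (?P \<rho> x) = x" if "x \<in> cube n" for x
      by (rule cube_eqI[OF c1[OF c2[OF that]] that]) (simp add: in1 rp)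
  qed (use c1 c2 in auto)
  \<comment> \<open>\<open>\<pi>\<close> itself carries the positions where the reindexed vertices
    differ onto those where \<open>x\<close> and \<open>y\<close> differ.\<close>
  moreover have "card {i \<in> {..<n}. ?P \<pi> x i \<noteq> ?P \<pi> y i} = card {i \<in> {..<n}. x i \<noteq> y i}" for x y
  proof (rule bij_betw_same_card[of \<pi>])
    show "bij_betw \<pi> {i \<in> {..<n}. ?P \<pi> x i \<noteq> ?P \<pi> y i} {i \<in> {..<n}. x i \<noteq> y i}"
      by (rule bij_betwI[where g = \<rho>]) (use in1 in2 pr rp in auto)
  qed
  ultimately show ?thesis
    unfolding cube_automorphism_def cube_adj_def using c1 by auto
qed

section \<open>Walsh--Fourier expansion\<close>

definition fourier :: "nat \<Rightarrow> ((nat \<Rightarrow> real) \<Rightarrow> real) \<Rightarrow> nat set \<Rightarrow> real" where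
  "fourier n f S = (\<Sum>x\<in>cube n. f x * prod x S) / 2 ^ n"

text \<open>The sum over all \<open>S\<close> is the expanded product of the factors
  \<open>x i * y i + 1\<close>; each factor is 2 where the vertices agree and 0 where they
  differ.\<close>

lemma sum_walsh_kernel:
  assumes "x \<in> cube n" "y \<in> cube n"
  shows "(\<Sum>S\<in>Pow {..<n}. prod x S * prod y S) = (if x = y then 2 ^ n else 0)"
proof -
  have "(\<Sum>S\<in>Pow {..<n}. prod x S * prod y S) = (\<Prod>i<n. x i * y i + 1)"
    by (subst prod_add) (auto simp: prod.distrib)
  also have "\<dots> = (if x = y then 2 ^ n else 0)"
  proof (cases "x = y")
    case True
    then have "(\<Prod>i<n. x i * y i + 1) = (\<Prod>i<n. 2)"
      using cube_mult_self[OF assms(1)] by (intro prod.cong) auto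
    then show ?thesis using True by simp
  next
    case False
    then obtain i where i: "i < n" "x i \<noteq> y i" using cube_eqI[OF assms] by blast
    then have "x i * y i + 1 = 0"
      using cube_cases[OF assms(1), of i] cube_cases[OF assms(2), of i] by auto
    then have "(\<Prod>i<n. x i * y i + 1) = 0" using i by (intro prod_zero) auto
    then show ?thesis using False by simp
  qed
  finally show ?thesis .
qed

lemma fourier_inversion:
  assumes "x \<in> cube n"
  shows "f x = (\<Sum>S\<in>Pow {..<n}. fourier n f S * prod x S)"
proof -
  have "(\<Sum>S\<in>Pow {..<n}. fourier n f S * prod x S)
      = (\<Sum>S\<in>Pow {..<n}. \<Sum>y\<in>cube n. f y / 2 ^ n * (prod x S * prod y S))"
    unfolding fourier_def
    by (intro sum.cong) (simp_all add: sum_divide_distrib sum_distrib_left mult_ac)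
  also have "\<dots> = (\<Sum>y\<in>cube n. f y / 2 ^ n * (\<Sum>S\<in>Pow {..<n}. prod x S * prod y S))"
    by (subst sum.swap) (simp add: sum_distrib_left)
  also have "\<dots> = (\<Sum>y\<in>cube n. if x = y then f y else 0)"
    using sum_walsh_kernel[OF assms] by (intro sum.cong) auto
  also have "\<dots> = f x"
    using assms finite_cube by simp
  finally show ?thesis ..
qed

text \<open>Inserting the definition of one factor and inverting the other turns the sum into the
  mean of the squares of \<open>f\<close>, which are all 1.\<close>

lemma parseval_boolean:
  assumes "f \<in> boolean_functions n"
  shows "(\<Sum>S\<in>Pow {..<n}. (fourier n f S)\<^sup>2) = 1"
proof -
  have "(\<Sum>S\<in>Pow {..<n}. (fourier n f S)\<^sup>2)
      = (\<Sum>S\<in>Pow {..<n}. \<Sum>x\<in>cube n. f x / 2 ^ n * (fourier n f S * prod x S))"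
  proof (intro sum.cong refl)
    fix S
    have "(fourier n f S)\<^sup>2 = fourier n f S * ((\<Sum>x\<in>cube n. f x * prod x S) / 2 ^ n)"
      unfolding power2_eq_square by (simp add: fourier_def)
    then show "(fourier n f S)\<^sup>2 = (\<Sum>x\<in>cube n. f x / 2 ^ n * (fourier n f S * prod x S))"
      by (simp add: sum_divide_distrib sum_distrib_left mult_ac)
  qed
  also have "\<dots> = (\<Sum>x\<in>cube n. f x / 2 ^ n * (\<Sum>S\<in>Pow {..<n}. fourier n f S * prod x S))"
    by (subst sum.swap) (simp add: sum_distrib_left)
  also have "\<dots> = (\<Sum>x\<in>cube n. 1 / 2 ^ n)"
    using fourier_inversion[of _ n f] boolean_cases[OF assms] by (intro sum.cong) fastforce+
  also have "\<dots> = 1"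
    by (simp add: card_cube)
  finally show ?thesis .
qed

lemma abs_fourier_le_1:
  assumes "f \<in> boolean_functions n" "S \<subseteq> {..<n}"
  shows "\<bar>fourier n f S\<bar> \<le> 1"
proof -
  have "(fourier n f S)\<^sup>2 \<le> (\<Sum>S\<in>Pow {..<n}. (fourier n f S)\<^sup>2)"
    using assms(2) by (intro member_le_sum) auto
  then show ?thesis
    unfolding parseval_boolean[OF assms(1)] by (simp add: abs_square_le_1)
qed

text \<open>At each vertex \<open>n - k\<close> flips keep the value and \<open>k\<close> negate it,
  which gives the eigenvalue.\<close>

lemma sum_flips_k_function:
  assumes "f \<in> k_functions n k" "x \<in> cube n"
  shows "(\<Sum>i<n. f (flip i x)) = (real n - 2 * real k) * f x"
proof -
  let ?D = "{i \<in> {..<n}. f x \<noteq> f (flip i x)}"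
  have c: "card ?D = k" using assms unfolding k_functions_iff by auto
  have "(\<Sum>i<n. f (flip i x)) = (\<Sum>i<n. f x - 2 * f x * (if i \<in> ?D then 1 else 0))"
  proof (intro sum.cong refl)
    fix i assume "i \<in> {..<n}"
    then show "f (flip i x) = f x - 2 * f x * (if i \<in> ?D then 1 else 0)"
      using k_function_cases[OF assms] k_function_cases[OF assms(1) flip_in_cube[OF assms(2), of i]]
      by auto
  qed
  also have "\<dots> = real n * f x - 2 * f x * (\<Sum>i<n. if i \<in> ?D then 1 else 0)"
    by (simp only: sum_subtractf sum_distrib_left[symmetric]) simp
  also have "(\<Sum>i<n. if i \<in> ?D then 1 else 0 :: real) = real k"
  proof -
    have "(\<Sum>i<n. if i \<in> ?D then 1 else 0 :: real) = (\<Sum>i\<in>{..<n} \<inter> ?D. 1)"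
      by (rule sum.inter_restrict[symmetric]) simp
    also have "{..<n} \<inter> ?D = ?D" by auto
    finally show ?thesis using c by simp
  qed
  finally show ?thesis by (simp add: algebra_simps)
qed

text \<open>A \<open>k\<close>-function is an eigenfunction of the adjacency operator for the eigenvalue \<open>n - 2k\<close>,
  whose eigenspace is spanned by the characters of the \<open>k\<close>-sets.\<close>

lemma fourier_k_function_eq_0:
  assumes "f \<in> k_functions n k" "S \<subseteq> {..<n}" "card S \<noteq> k"
  shows "fourier n f S = 0"
proof -
  have fin: "finite S" using assms(2) finite_subset by blast
  let ?s = "\<Sum>x\<in>cube n. f x * prod x S"
  have "(real n - 2 * real k) * ?s = (\<Sum>x\<in>cube n. \<Sum>i<n. f (flip i x) * prod x S)"
    by (simp add: sum_distrib_right[symmetric] sum_flips_k_function[OF assms(1)] mult.assoc)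
      (simp add: sum_distrib_left)
  also have "\<dots> = (\<Sum>i<n. \<Sum>x\<in>cube n. f (flip i x) * prod x S)"
    by (rule sum.swap)
  \<comment> \<open>Self-adjointness of the adjacency operator: each flip is an involution of the
    cube, so it can be moved from \<open>f\<close> to the character.\<close>
  also have "\<dots> = (\<Sum>i<n. \<Sum>x\<in>cube n. f x * prod (flip i x) S)"
  proof (rule sum.cong[OF refl])
    fix i assume "i \<in> {..<n}"
    then have "bij_betw (flip i) (cube n) (cube n)" by (auto intro: bij_betw_flip)
    from sum.reindex_bij_betw[OF this, of "\<lambda>x. f x * prod (flip i x) S"]
    show "(\<Sum>x\<in>cube n. f (flip i x) * prod x S) = (\<Sum>x\<in>cube n. f x * prod (flip i x) S)"
      by simp
  qed
  also have "\<dots> = (\<Sum>i<n. (1 - 2 * (if i \<in> S then 1 else 0)) * ?s)"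
    using fin by (intro sum.cong refl) (auto simp: prod_flip sum_negf)
  also have "\<dots> = (real n - 2 * (\<Sum>i<n. if i \<in> S then 1 else 0)) * ?s"
    by (simp only: sum_distrib_right[symmetric] sum_subtractf sum_distrib_left[symmetric]) simp
  also have "(\<Sum>i<n. if i \<in> S then 1 else 0 :: real) = real (card S)"
    by (subst sum.inter_restrict[symmetric]) (use assms(2) in \<open>auto simp: Int_absorb1\<close>)
  \<comment> \<open>\<open>?s\<close> has been multiplied by the eigenvalue of \<open>f\<close> on
    one side and by that of the character on the other; these differ unless
    \<open>card S = k\<close>.\<close>
  finally have "?s = 0" using assms(3) by auto
  then show ?thesis unfolding fourier_def by simp
qed

lemma k_function_expansion:
  assumes "f \<in> k_functions n k" "x \<in> cube n"
  shows "f x = (\<Sum>S | S \<subseteq> {..<n} \<and> card S = k. fourier n f S * prod x S)"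
  unfolding fourier_inversion[OF assms(2), of f]
  by (rule sum.mono_neutral_right) (use fourier_k_function_eq_0[OF assms(1)] in auto)

section \<open>Granularity and sparsity of the coefficients\<close>

lemma prod_sign_vec:
  assumes "T \<subseteq> {..<n}"
  shows "prod (sign_vec n A) T = (-1) ^ card (A \<inter> T)"
proof -
  have fin: "finite T" using assms finite_subset by blast
  have "prod (sign_vec n A) T = (\<Prod>i\<in>T. if i \<in> A then -1 else 1)"
    unfolding sign_vec_def using assms by (intro prod.cong) auto
  also have "\<dots> = (\<Prod>i\<in>T \<inter> A. -1)"
    by (rule prod.inter_restrict[OF fin, symmetric])
  finally show ?thesis by (simp add: Int_commute)
qed

text \<open>Restricting the coordinates outside \<open>S\<close> to \<open>1\<close> leaves the coefficient at \<open>S\<close> unchanged, as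
  no character of a \<open>k\<close>-set other than \<open>S\<close> restricts to that of \<open>S\<close>.\<close>

lemma fourier_k_function_local:
  assumes "f \<in> k_functions n k" "S \<subseteq> {..<n}" "card S = k"
  shows "2 ^ k * fourier n f S = (\<Sum>A\<in>Pow S. (-1) ^ card A * f (sign_vec n A))"
proof -
  let ?K = "{S. S \<subseteq> {..<n} \<and> card S = k}"
  have fin: "finite S" using assms(2) finite_subset by blast
  have finK: "finite ?K" by (rule finite_subset[of _ "Pow {..<n}"]) auto
  \<comment> \<open>The alternating sum factors over \<open>i \<in> S\<close>, with factor 2 for
    \<open>i \<in> T\<close> and 0 otherwise. It survives only if \<open>S \<subseteq> T\<close>,
    which forces equality since both sets have \<open>k\<close> elements.\<close>
  have inner: "(\<Sum>A\<in>Pow S. (-1) ^ card A * prod (sign_vec n A) T) = (if T = S then 2 ^ k else 0)"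
    if T: "T \<in> ?K" for T
  proof -
    have "(\<Sum>A\<in>Pow S. (-1) ^ card A * prod (sign_vec n A) T)
        = (\<Sum>A\<in>Pow S. (\<Prod>i\<in>A. - (if i \<in> T then -1 else 1)) * (\<Prod>i\<in>S-A. 1))"
    proof (intro sum.cong refl)
      fix A assume "A \<in> Pow S"
      then have "finite A" using fin finite_subset by blast
      have "(\<Prod>i\<in>A. - (if i \<in> T then -1 else 1 :: real))
          = (\<Prod>i\<in>A. -1) * (\<Prod>i\<in>A. if i \<in> T then -1 else 1)"
        unfolding prod.distrib[symmetric] by (intro prod.cong) auto
      also have "(\<Prod>i\<in>A. if i \<in> T then -1 else 1 :: real) = (\<Prod>i\<in>A \<inter> T. -1)"
        by (rule prod.inter_restrict[OF \<open>finite A\<close>, symmetric])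
      finally show "(-1) ^ card A * prod (sign_vec n A) T
          = (\<Prod>i\<in>A. - (if i \<in> T then -1 else 1)) * (\<Prod>i\<in>S-A. 1)"
        using T by (simp add: prod_sign_vec)
    qed
    also have "\<dots> = (\<Prod>i\<in>S. - (if i \<in> T then -1 else 1) + 1)"
      using fin by (simp only: prod_add)
    also have "\<dots> = (if T = S then 2 ^ k else 0)"
    proof (cases "T = S")
      case True
      then have "(\<Prod>i\<in>S. - (if i \<in> T then -1 else 1) + 1 :: real) = (\<Prod>i\<in>S. 2)"
        by (intro prod.cong) auto
      then show ?thesis using True assms by simp
    next
      case False
      have "\<not> S \<subseteq> T"
        using False T assms(3) card_subset_eq[of T S] finite_subset[of T "{..<n}"] by auto
      then obtain i where "i \<in> S" "i \<notin> T" by auto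
      then show ?thesis using False fin by (auto intro!: prod_zero)
    qed
    finally show ?thesis .
  qed
  have "(\<Sum>A\<in>Pow S. (-1) ^ card A * f (sign_vec n A))
      = (\<Sum>A\<in>Pow S. \<Sum>T\<in>?K. fourier n f T * ((-1) ^ card A * prod (sign_vec n A) T))"
    by (subst k_function_expansion[OF assms(1) sign_vec_in_cube])
      (simp add: sum_distrib_left mult_ac)
  also have "\<dots> = (\<Sum>T\<in>?K. fourier n f T * (\<Sum>A\<in>Pow S. (-1) ^ card A * prod (sign_vec n A) T))"
    by (subst sum.swap) (simp add: sum_distrib_left)
  also have "\<dots> = (\<Sum>T\<in>?K. if T = S then 2 ^ k * fourier n f T else 0)"
    using inner by (intro sum.cong) auto
  also have "\<dots> = 2 ^ k * fourier n f S"
    using finK assms(2,3) by simp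
  finally show ?thesis ..
qed

text \<open>The local formula writes the scaled coefficient as a sum of terms equal to -1 or
  1.\<close>

lemma fourier_k_function_granular:
  assumes "f \<in> k_functions n k" "S \<subseteq> {..<n}" "card S = k"
  shows "2 ^ k * fourier n f S \<in> \<int>"
proof -
  have "(-1) ^ card A * f (sign_vec n A) \<in> \<int>" for A
    using k_function_cases[OF assms(1) sign_vec_in_cube[of n A]] by auto
  then show ?thesis unfolding fourier_k_function_local[OF assms] by (intro Ints_sum)
qed

text \<open>By granularity every nonzero coefficient has square at least \<open>1 / 4 ^ k\<close>,
  while by Parseval the squares add up to 1.\<close>

lemma card_fourier_support_le:
  assumes "f \<in> k_functions n k"
  shows "card {S. S \<subseteq> {..<n} \<and> fourier n f S \<noteq> 0} \<le> 4 ^ k"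
proof -
  let ?F = "{S. S \<subseteq> {..<n} \<and> fourier n f S \<noteq> 0}"
  have bf: "f \<in> boolean_functions n" using assms unfolding k_functions_def by auto
  have "1 / 4 ^ k \<le> (fourier n f S)\<^sup>2" if "S \<in> ?F" for S
  proof -
    have S: "S \<subseteq> {..<n}" "card S = k" "fourier n f S \<noteq> 0"
      using that fourier_k_function_eq_0[OF assms, of S] by auto
    have "1 \<le> \<bar>2 ^ k * fourier n f S\<bar>"
      using Ints_nonzero_abs_ge1[OF fourier_k_function_granular[OF assms S(1,2)]] S(3) by simp
    then have "1 \<le> (2 ^ k * fourier n f S)\<^sup>2"
      by (metis abs_ge_zero one_le_power power2_abs)
    then show ?thesis
      by (simp add: power_mult_distrib field_simps power2_eq_square[of "2 ^ k"]
          power_mult_distrib[symmetric])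
  qed
  then have "real (card ?F) * (1 / 4 ^ k) \<le> (\<Sum>S\<in>?F. (fourier n f S)\<^sup>2)"
    by (intro sum_bounded_below)
  also have "\<dots> \<le> (\<Sum>S\<in>Pow {..<n}. (fourier n f S)\<^sup>2)"
    by (intro sum_mono2) auto
  finally have "real (card ?F) \<le> 4 ^ k"
    unfolding parseval_boolean[OF bf] by (simp add: field_simps)
  then show ?thesis
    by (metis of_nat_le_iff of_nat_numeral of_nat_power)
qed

section \<open>Rigidity of cube automorphisms\<close>

text \<open>A nonzero coefficient sits at a singleton and is half the difference of two signs, hence
  -1 or 1. It exhausts the Parseval sum, so every other coefficient vanishes.\<close>

lemma one_function_dictator:
  assumes "f \<in> k_functions n 1"
  shows "\<exists>j<n. \<exists>s\<in>{-1, 1}. \<forall>x\<in>cube n. f x = s * x j"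
proof -
  have bf: "f \<in> boolean_functions n" using assms unfolding k_functions_def by auto
  have "\<exists>S\<in>Pow {..<n}. (fourier n f S)\<^sup>2 \<noteq> 0"
    using parseval_boolean[OF bf] by (metis (no_types, lifting) sum.neutral zero_neq_one)
  then obtain S where S: "S \<subseteq> {..<n}" "fourier n f S \<noteq> 0" by auto
  then have "card S = 1" using fourier_k_function_eq_0[OF assms, of S] by auto
  then obtain j where j: "S = {j}" using card_1_singletonE by blast
  then have jn: "j < n" using S by auto
  let ?c = "fourier n f {j}"
  have c0: "?c \<noteq> 0" using S j by simp
  have "2 * ?c = f (sign_vec n {}) - f (sign_vec n {j})"
    using fourier_k_function_local[OF assms, of "{j}"] jn by (simp add: Pow_insert)
  then have c: "?c \<in> {-1, 1}"
    using k_function_cases[OF assms sign_vec_in_cube[of n "{}"]]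
      k_function_cases[OF assms sign_vec_in_cube[of n "{j}"]] c0 by auto
  have "(\<Sum>S\<in>Pow {..<n}. (fourier n f S)\<^sup>2)
      = ?c\<^sup>2 + (\<Sum>S\<in>Pow {..<n} - {{j}}. (fourier n f S)\<^sup>2)"
    using jn by (intro sum.remove) auto
  then have "(\<Sum>S\<in>Pow {..<n} - {{j}}. (fourier n f S)\<^sup>2) = 0"
    using parseval_boolean[OF bf] c by auto
  then have z: "fourier n f S = 0" if "S \<in> Pow {..<n} - {{j}}" for S
    using that by (subst (asm) sum_nonneg_eq_0_iff) auto
  have "f x = ?c * x j" if "x \<in> cube n" for x
  proof -
    have "f x = (\<Sum>S\<in>Pow {..<n}. fourier n f S * prod x S)"
      by (rule fourier_inversion[OF that])
    also have "\<dots> = (\<Sum>S\<in>{{j}}. fourier n f S * prod x S)"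
      using jn z by (intro sum.mono_neutral_right) auto
    finally show ?thesis by simp
  qed
  then show ?thesis using jn c by blast
qed

text \<open>The \<open>i\<close>-th coordinate is the 1-function \<open>walsh n {i}\<close>; its
  pullback along \<open>\<phi>\<close> is again a 1-function, hence a signed coordinate.\<close>

lemma automorphism_coordinate:
  assumes "cube_automorphism n \<phi>" "i < n"
  shows "\<exists>j<n. \<exists>s\<in>{-1, 1}. \<forall>x\<in>cube n. \<phi> x i = s * x j"
proof -
  have "walsh n {i} \<in> k_functions n 1"
    using walsh_k_function[of "{i}" n] assms(2) by simp
  from one_function_dictator[OF k_functions_automorphism[OF assms(1) this]]
  obtain j s where "j < n" "s \<in> {-1, 1}"
    "\<And>x. x \<in> cube n \<Longrightarrow> (\<lambda>x\<in>cube n. walsh n {i} (\<phi> x)) x = s * x j"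
    by blast
  then show ?thesis
    using automorphism_in_cube[OF assms(1)] by (fastforce simp: walsh_def)
qed

lemma automorphism_signed_coordinates:
  assumes "cube_automorphism n \<phi>"
  shows "\<exists>j s. (\<forall>i<n. j i < n) \<and> (\<forall>i<n. s i \<in> {-1, 1}) \<and>
    (\<forall>i<n. \<forall>x\<in>cube n. \<phi> x i = s i * x (j i))"
proof -
  let ?P = "\<lambda>i j s. j < n \<and> s \<in> {-1, 1} \<and> (\<forall>x\<in>cube n. \<phi> x i = s * x j)"
  define j where "j i = (SOME j. \<exists>s. ?P i j s)" for i
  define s where "s i = (SOME s. ?P i (j i) s)" for i
  have "?P i (j i) (s i)" if "i < n" for i
  proof -
    have "\<exists>j s. ?P i j s" using automorphism_coordinate[OF assms that] by blast
    then have "\<exists>s. ?P i (j i) s" unfolding j_def by (rule someI_ex)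
    then show ?thesis unfolding s_def by (rule someI_ex)
  qed
  then show ?thesis by (intro exI[of _ j] exI[of _ s]) simp
qed

text \<open>Full parity is an \<open>n\<close>-function, and so is its pullback. Since
  \<open>{..<n}\<close> is the only subset of size \<open>n\<close>, the pullback is a multiple of
  full parity.\<close>

lemma automorphism_parity:
  assumes "cube_automorphism n \<phi>"
  shows "\<exists>s\<in>{-1, 1}. \<forall>x\<in>cube n. prod (\<phi> x) {..<n} = s * prod x {..<n}"
proof -
  define f where "f = (\<lambda>x\<in>cube n. walsh n {..<n} (\<phi> x))"
  have f: "f \<in> k_functions n n"
    unfolding f_def using k_functions_automorphism[OF assms walsh_k_function[of "{..<n}" n]] by simp
  let ?c = "fourier n f {..<n}"
  have "{S. S \<subseteq> {..<n} \<and> card S = n} = {{..<n}}"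
    using card_subset_eq[of "{..<n}"] by auto
  then have e: "f x = ?c * prod x {..<n}" if "x \<in> cube n" for x
    using k_function_expansion[OF f that] by simp
  \<comment> \<open>At the all-ones vertex full parity is 1, so \<open>?c\<close> is a value of
    \<open>f\<close>.\<close>
  have "?c \<in> {-1, 1}"
    using e[OF sign_vec_in_cube[of n "{}"]] k_function_cases[OF f sign_vec_in_cube[of n "{}"]]
      prod_sign_vec[of "{..<n}" n "{}"] by auto
  moreover have "f x = prod (\<phi> x) {..<n}" if "x \<in> cube n" for x
    unfolding f_def walsh_def using that automorphism_in_cube[OF assms] by auto
  ultimately show ?thesis using e by metis
qed

section \<open>Counting isomorphism classes\<close>

text \<open>Every class is that of some member of \<open>H\<close>, so \<open>H\<close> maps onto a
  superset of the quotient; this is the tool for upper bounds on \<open>G\<close>.\<close>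

lemma card_quotient_le_card:
  assumes "equiv A r" "finite H" "\<And>x. x \<in> A \<Longrightarrow> \<exists>h\<in>H. (x, h) \<in> r"
  shows "card (A // r) \<le> card H"
proof -
  have "A // r \<subseteq> (\<lambda>h. r `` {h}) ` H"
  proof
    fix X assume "X \<in> A // r"
    then obtain x where x: "x \<in> A" "X = r `` {x}" by (rule quotientE)
    then obtain h where "h \<in> H" "(x, h) \<in> r" using assms(3) by blast
    then show "X \<in> (\<lambda>h. r `` {h}) ` H"
      using x equiv_class_eq[OF assms(1)] by blast
  qed
  then show ?thesis using assms(2) by (meson card_image_le card_mono finite_imageI le_trans)
qed

text \<open>Partition \<open>B\<close> by the class of \<open>F b\<close>: there are at most
  \<open>card (A // r)\<close> parts, each of size at most \<open>M\<close>. This is the tool for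
  lower bounds on \<open>G\<close>.\<close>

lemma card_le_card_quotient_mult:
  assumes "equiv A r" "finite A" "finite B" "\<And>b. b \<in> B \<Longrightarrow> F b \<in> A"
    and "\<And>b. b \<in> B \<Longrightarrow> card {b' \<in> B. (F b', F b) \<in> r} \<le> M"
  shows "card B \<le> card (A // r) * M"
proof -
  let ?q = "\<lambda>b. r `` {F b}"
  have sub: "?q ` B \<subseteq> A // r" using assms(4) by (auto intro: quotientI)
  have finq: "finite (A // r)"
    using assms(1,2) by (meson equiv_type finite_quotient)
  have "card B = (\<Sum>X\<in>?q ` B. card {b \<in> B. ?q b = X})"
    using sum.image_gen[OF assms(3), of "\<lambda>_. 1::nat" ?q] by simp
  also have "\<dots> \<le> (\<Sum>X\<in>?q ` B. M)"
  proof (rule sum_mono)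
    fix X assume "X \<in> ?q ` B"
    then obtain b where b: "b \<in> B" "X = ?q b" by auto
    have "{b' \<in> B. ?q b' = X} \<subseteq> {b' \<in> B. (F b', F b) \<in> r}"
      using b assms(4) eq_equiv_class[OF _ assms(1)] by auto
    then have "card {b' \<in> B. ?q b' = X} \<le> card {b' \<in> B. (F b', F b) \<in> r}"
      using assms(3) by (intro card_mono) auto
    then show "card {b' \<in> B. ?q b' = X} \<le> M"
      using assms(5)[OF b(1)] by simp
  qed
  also have "\<dots> \<le> card (A // r) * M"
    using card_mono[OF finq sub] by simp
  finally show ?thesis .
qed

section \<open>Complementation by the full parity character\<close>

definition times_parity :: "nat \<Rightarrow> ((nat \<Rightarrow> real) \<Rightarrow> real) \<Rightarrow> (nat \<Rightarrow> real) \<Rightarrow> real" where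
  "times_parity n f = (\<lambda>x\<in>cube n. f x * prod x {..<n})"

text \<open>Every flip negates full parity, so multiplication by it exchanges sensitive and
  insensitive coordinates.\<close>

lemma times_parity_k_function:
  assumes "f \<in> k_functions n k" "k \<le> n"
  shows "times_parity n f \<in> k_functions n (n - k)"
proof -
  have "times_parity n f x \<in> {-1, 1}" if "x \<in> cube n" for x
    using k_function_cases[OF assms(1) that] prod_cube_cases[OF that, of "{..<n}"] that
    unfolding times_parity_def by auto
  then have "times_parity n f \<in> boolean_functions n"
    unfolding boolean_functions_def times_parity_def by auto
  moreover have "card {i \<in> {..<n}. times_parity n f x \<noteq> times_parity n f (flip i x)} = n - k"
    if x: "x \<in> cube n" for x
  proof -
    have "times_parity n f x \<noteq> times_parity n f (flip i x) \<longleftrightarrow> f x = f (flip i x)"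
      if "i < n" for i
      using x that flip_in_cube[OF x that] k_function_cases[OF assms(1) x]
        k_function_cases[OF assms(1) flip_in_cube[OF x that]] prod_cube_cases[OF x, of "{..<n}"]
      unfolding times_parity_def by (auto simp: prod_flip)
    then have "{i \<in> {..<n}. times_parity n f x \<noteq> times_parity n f (flip i x)}
        = {..<n} - {i \<in> {..<n}. f x \<noteq> f (flip i x)}"
      by auto
    then have "card {i \<in> {..<n}. times_parity n f x \<noteq> times_parity n f (flip i x)}
        = card {..<n} - card {i \<in> {..<n}. f x \<noteq> f (flip i x)}"
      by (metis (no_types, lifting) card_Diff_subset finite_lessThan finite_subset
          mem_Collect_eq subsetI)
    then show ?thesis
      using assms(1) x unfolding k_functions_iff by simp
  qed
  ultimately show ?thesis unfolding k_functions_iff by auto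
qed

lemma times_parity_times_parity:
  assumes "f \<in> k_functions n k"
  shows "times_parity n (times_parity n f) = f"
proof
  fix x
  show "times_parity n (times_parity n f) x = f x"
  proof (cases "x \<in> cube n")
    case True
    then show ?thesis
      using prod_cube_cases[OF True, of "{..<n}"] unfolding times_parity_def by auto
  next
    case False
    then show ?thesis
      using assms unfolding times_parity_def k_functions_def boolean_functions_def
      by (auto simp: PiE_iff extensional_def)
  qed
qed

text \<open>The same automorphism serves; the sign by which it changes full parity is absorbed into
  \<open>\<epsilon>\<close>.\<close>

lemma cube_isomorphic_times_parity:
  assumes "cube_isomorphic n f g"
  shows "cube_isomorphic n (times_parity n f) (times_parity n g)"
proof -
  obtain \<phi> \<epsilon> where p: "cube_automorphism n \<phi>" "\<epsilon> \<in> {-1, 1}"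
    "\<And>x. x \<in> cube n \<Longrightarrow> f x = \<epsilon> * g (\<phi> x)"
    using assms unfolding cube_isomorphic_def by blast
  obtain s where s: "s \<in> {-1, 1}"
    "\<And>x. x \<in> cube n \<Longrightarrow> prod (\<phi> x) {..<n} = s * prod x {..<n}"
    using automorphism_parity[OF p(1)] by blast
  have "times_parity n f x = (\<epsilon> * s) * times_parity n g (\<phi> x)" if "x \<in> cube n" for x
    using that p(3)[OF that] s(1) s(2)[OF that] automorphism_in_cube[OF p(1) that]
    unfolding times_parity_def by auto
  moreover have "\<epsilon> * s \<in> {-1, 1}" using p(2) s(1) by auto
  ultimately show ?thesis unfolding cube_isomorphic_def using p(1) by blast
qed

lemma G_complement_le:
  assumes "k \<le> n"
  shows "G n k \<le> G n (n - k)"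
proof -
  let ?r = "iso_rel n k" and ?s = "iso_rel n (n - k)"
  \<comment> \<open>One representative is chosen from each class of \<open>(n - k)\<close>-functions
    and multiplied by full parity; the results meet every class of
    \<open>k\<close>-functions.\<close>
  let ?H = "(\<lambda>X. times_parity n (SOME g. g \<in> X)) ` (k_functions n (n - k) // ?s)"
  have fin: "finite (k_functions n (n - k) // ?s)"
    using equiv_iso_rel by (meson equiv_type finite_k_functions finite_quotient)
  have "\<exists>h\<in>?H. (f, h) \<in> ?r" if f: "f \<in> k_functions n k" for f
  proof -
    define X where "X = ?s `` {times_parity n f}"
    define g where "g = (SOME g. g \<in> X)"
    have tf: "times_parity n f \<in> k_functions n (n - k)"
      by (rule times_parity_k_function[OF f assms])
    have "times_parity n f \<in> X"
      unfolding X_def using equiv_class_self[OF equiv_iso_rel tf] .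
    then have "g \<in> X" unfolding g_def by (metis someI)
    then have g: "g \<in> k_functions n (n - k)" "cube_isomorphic n (times_parity n f) g"
      unfolding X_def iso_rel_def by auto
    have "cube_isomorphic n f (times_parity n g)"
      using cube_isomorphic_times_parity[OF g(2)] times_parity_times_parity[OF f] by simp
    moreover have "times_parity n g \<in> k_functions n k"
      using times_parity_k_function[OF g(1)] assms by simp
    ultimately have "(f, times_parity n g) \<in> ?r" using f unfolding iso_rel_def by auto
    moreover have "times_parity n g \<in> ?H"
      unfolding g_def X_def using quotientI[OF tf, of ?s] by blast
    ultimately show ?thesis by blast
  qed
  then have "G n k \<le> card ?H"
    unfolding G_def using fin by (intro card_quotient_le_card[OF equiv_iso_rel]) auto
  also have "\<dots> \<le> G n (n - k)"
    unfolding G_def by (rule card_image_le[OF fin])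
  finally show ?thesis .
qed

lemma G_min:
  assumes "k \<le> n"
  shows "G n k = G n (min k (n - k))"
  using G_complement_le[OF assms] G_complement_le[of "n - k" n] assms
  by (cases "k \<le> n - k") (auto simp: min_def)

section \<open>The upper bound\<close>

text \<open>Glue a bijection from \<open>V\<close> to an initial segment with one between the
  complements. It moves the variables of a function to the front.\<close>

lemma ex_permutation_image_lessThan:
  assumes "V \<subseteq> {..<n}"
  shows "\<exists>\<pi>. bij_betw \<pi> {..<n} {..<n} \<and> \<pi> ` V = {..<card V}"
proof -
  have finV: "finite V" using assms finite_subset by blast
  have cV: "card V \<le> n" using card_mono[OF _ assms] by simp
  obtain p where p: "bij_betw p V {..<card V}"
    using finite_same_card_bij[OF finV, of "{..<card V}"] by auto
  have "card ({..<n} - V) = card {card V..<n}"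
    using assms finV by (simp add: card_Diff_subset)
  then obtain q where q: "bij_betw q ({..<n} - V) {card V..<n}"
    using finite_same_card_bij[of "{..<n} - V" "{card V..<n}"] by auto
  define \<pi> where "\<pi> i = (if i \<in> V then p i else q i)" for i
  have 1: "bij_betw \<pi> V {..<card V}"
    using p by (subst bij_betw_cong[of _ _ p]) (auto simp: \<pi>_def)
  moreover have "bij_betw \<pi> ({..<n} - V) {card V..<n}"
    using q by (subst bij_betw_cong[of _ _ q]) (auto simp: \<pi>_def)
  ultimately have "bij_betw \<pi> (V \<union> ({..<n} - V)) ({..<card V} \<union> {card V..<n})"
    by (rule bij_betw_combine) auto
  moreover have "V \<union> ({..<n} - V) = {..<n}" using assms by auto
  moreover have "{..<card V} \<union> {card V..<n} = {..<n}" using cV by auto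
  ultimately show ?thesis using 1 by (metis bij_betw_imp_surj_on)
qed

text \<open>Each class has a representative encoded by \<open>4 ^ k\<close> pairs of a
  \<open>k\<close>-set below \<open>N\<close> and a coefficient; the number of such codes does not
  depend on \<open>n\<close>.\<close>

lemma G_upper_bound: "G n k \<le> ((k * 4 ^ k) ^ k * (2 ^ (k + 1) + 1)) ^ (4 ^ k)"
proof -
  \<comment> \<open>At most \<open>4 ^ k\<close> characters of \<open>k\<close> variables each
    occur, so \<open>N\<close> bounds the number of relevant coordinates.\<close>
  define N where "N = k * 4 ^ k"
  define X where "X = {S. S \<subseteq> {..<N} \<and> card S = k}"
  \<comment> \<open>All multiples of \<open>1 / 2 ^ k\<close> in the interval from -1 to 1, which is
    where the coefficients lie.\<close>
  define Y where "Y = (\<lambda>z. real_of_int z / 2 ^ k) ` {- (2 ^ k)..2 ^ k}"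
  define C where "C = {..<4 ^ k :: nat} \<rightarrow>\<^sub>E X \<times> Y"
  define D where "D c = (\<lambda>x\<in>cube n. \<Sum>j<4 ^ k. snd (c j) * prod x (fst (c j)))"
    for c :: "nat \<Rightarrow> nat set \<times> real"
  have finX: "finite X" unfolding X_def by (rule finite_subset[of _ "Pow {..<N}"]) auto
  have finY: "finite Y" unfolding Y_def by simp
  have finC: "finite C" unfolding C_def using finX finY by (intro finite_PiE) auto
  have "\<exists>h\<in>D ` C. (f, h) \<in> iso_rel n k" if f: "f \<in> k_functions n k" for f
  proof -
    define F where "F = {S. S \<subseteq> {..<n} \<and> fourier n f S \<noteq> 0}"
    have bf: "f \<in> boolean_functions n" using f unfolding k_functions_def by auto
    have finF: "finite F" unfolding F_def by (rule finite_subset[of _ "Pow {..<n}"]) auto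
    have cF: "card F \<le> 4 ^ k" unfolding F_def by (rule card_fourier_support_le[OF f])
    have FS: "S \<subseteq> {..<n}" "card S = k" if "S \<in> F" for S
      using that fourier_k_function_eq_0[OF f, of S] unfolding F_def by auto
    \<comment> \<open>A support set \<open>S0\<close> is needed to pad the code with a genuine
      element of \<open>X\<close>.\<close>
    have "\<exists>S\<in>Pow {..<n}. (fourier n f S)\<^sup>2 \<noteq> 0"
      using parseval_boolean[OF bf] by (metis (no_types, lifting) sum.neutral zero_neq_one)
    then obtain S0 where S0: "S0 \<in> F" unfolding F_def by auto
    define V where "V = \<Union>F"
    have VN: "V \<subseteq> {..<n}" unfolding V_def using FS by auto
    have "card V \<le> (\<Sum>S\<in>F. card S)"
      unfolding V_def using card_UN_le[OF finF, of "\<lambda>S. S"] by simp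
    also have "\<dots> = card F * k" using FS by simp
    also have "\<dots> \<le> N" unfolding N_def using cF by simp
    finally have cV: "card V \<le> N" .
    obtain \<pi> where \<pi>: "bij_betw \<pi> {..<n} {..<n}" "\<pi> ` V = {..<card V}"
      using ex_permutation_image_lessThan[OF VN] by blast
    have inj: "inj_on \<pi> S" if "S \<in> F" for S
      using \<pi>(1) FS[OF that] unfolding bij_betw_def by (meson inj_on_subset)
    have imX: "\<pi> ` S \<in> X" if "S \<in> F" for S
    proof -
      have "\<pi> ` S \<subseteq> {..<card V}" using \<pi>(2) that unfolding V_def by auto
      then show ?thesis
        unfolding X_def using cV FS[OF that] card_image[OF inj[OF that]] by auto
    qed
    have coeffY: "fourier n f S \<in> Y" if S: "S \<in> F" for S
    proof -
      obtain z where z: "2 ^ k * fourier n f S = real_of_int z"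
        using fourier_k_function_granular[OF f FS(1)[OF S] FS(2)[OF S]] Ints_cases by blast
      have "\<bar>real_of_int z\<bar> \<le> 2 ^ k"
        unfolding z[symmetric] using abs_fourier_le_1[OF bf FS(1)[OF S]]
        by (simp add: abs_mult)
      then have "\<bar>z\<bar> \<le> 2 ^ k"
        by (metis of_int_abs of_int_le_iff of_int_numeral of_int_power)
      then have "z \<in> {- (2 ^ k)..2 ^ k}" by auto
      moreover have "fourier n f S = real_of_int z / 2 ^ k" using z by (simp add: field_simps)
      ultimately show ?thesis unfolding Y_def by blast
    qed
    have zeroY: "0 \<in> Y" unfolding Y_def by (intro image_eqI[of _ _ 0]) auto
    obtain e where e: "bij_betw e {..<card F} F"
      using ex_bij_betw_nat_finite[OF finF] unfolding atLeast0LessThan by blast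
    have eF: "e j \<in> F" if "j < card F" for j using bij_betw_apply[OF e, of j] that by simp
    \<comment> \<open>The support is listed first; the remaining slots get coefficient 0 and add
      nothing to the decoded sum.\<close>
    define c where "c = (\<lambda>j\<in>{..<4 ^ k}. if j < card F then (\<pi> ` e j, fourier n f (e j))
      else (\<pi> ` S0, 0))"
    have cC: "c \<in> C"
      unfolding c_def C_def using eF imX coeffY zeroY S0 by auto
    define \<phi> where "\<phi> x = (\<lambda>i\<in>{..<n}. x (\<pi> i))" for x :: "nat \<Rightarrow> real"
    have \<phi>: "cube_automorphism n \<phi>"
      unfolding \<phi>_def by (rule permutation_automorphism[OF \<pi>(1)])
    have h: "D c = (\<lambda>x\<in>cube n. f (\<phi> x))"
    proof (rule ext)
      fix x
      show "D c x = (\<lambda>x\<in>cube n. f (\<phi> x)) x"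
      proof (cases "x \<in> cube n")
        case True
        have "f (\<phi> x) = (\<Sum>S\<in>F. fourier n f S * prod (\<phi> x) S)"
          unfolding fourier_inversion[OF automorphism_in_cube[OF \<phi> True], of f] F_def
          by (rule sum.mono_neutral_right) auto
        also have "\<dots> = (\<Sum>S\<in>F. fourier n f S * prod x (\<pi> ` S))"
        proof (rule sum.cong[OF refl])
          fix S assume S: "S \<in> F"
          have "prod x (\<pi> ` S) = (\<Prod>i\<in>S. x (\<pi> i))"
            using prod.reindex[OF inj[OF S], of x] by simp
          also have "\<dots> = prod (\<phi> x) S"
            unfolding \<phi>_def using FS[OF S] by (intro prod.cong) auto
          finally show "fourier n f S * prod (\<phi> x) S = fourier n f S * prod x (\<pi> ` S)" by simp
        qed
        also have "\<dots> = (\<Sum>j<card F. fourier n f (e j) * prod x (\<pi> ` e j))"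
          by (rule sum.reindex_bij_betw[OF e, symmetric])
        also have "\<dots> = (\<Sum>j<4 ^ k. snd (c j) * prod x (fst (c j)))"
          using cF by (intro sum.mono_neutral_cong_left) (auto simp: c_def)
        finally show ?thesis using True unfolding D_def by simp
      qed (simp add: D_def)
    qed
    have "D c \<in> k_functions n k" unfolding h by (rule k_functions_automorphism[OF \<phi> f])
    moreover have "cube_isomorphic n (D c) f"
      unfolding cube_isomorphic_def h using \<phi> by (intro exI[of _ \<phi>] exI[of _ 1]) auto
    ultimately have "(f, D c) \<in> iso_rel n k"
      using f cube_isomorphic_sym unfolding iso_rel_def by auto
    then show ?thesis using cC by blast
  qed
  then have "G n k \<le> card (D ` C)"
    unfolding G_def using finC by (intro card_quotient_le_card[OF equiv_iso_rel]) auto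
  also have "\<dots> \<le> card C" by (rule card_image_le[OF finC])
  also have "\<dots> = (card X * card Y) ^ (4 ^ k)"
    unfolding C_def by (simp add: card_PiE card_cartesian_product)
  also have "\<dots> \<le> (N ^ k * (2 ^ (k + 1) + 1)) ^ (4 ^ k)"
  proof (intro power_mono mult_mono)
    have "card X = N choose k" unfolding X_def using n_subsets[of "{..<N}" k] by simp
    also have "\<dots> \<le> N ^ k" by (rule binomial_le_pow) (simp add: N_def)
    finally show "card X \<le> N ^ k" .
    have "card Y \<le> card {- (2 ^ k)..(2 ^ k :: int)}" unfolding Y_def by (rule card_image_le) simp
    also have "\<dots> = nat (2 ^ (k + 1) + 1)" by simp
    also have "\<dots> = 2 ^ (k + 1) + 1" by (simp add: nat_add_distrib nat_mult_distrib nat_power_eq)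
    finally show "card Y \<le> 2 ^ (k + 1) + 1" .
  qed auto
  finally show ?thesis unfolding N_def .
qed

section \<open>The lower bound\<close>

definition agree :: "nat \<Rightarrow> (nat \<Rightarrow> real) \<Rightarrow> nat set" where
  "agree k x = {i \<in> {..<k}. x i = x (k + i)}"

definition selector :: "nat \<Rightarrow> nat set set \<Rightarrow> (nat \<Rightarrow> real) \<Rightarrow> real" where
  "selector k F x = (if agree k x \<in> F then 1 else -1) * prod x {..<k}"

text \<open>Stated for arbitrary real vectors, so that it also applies to decoded points that are
  not extensional.\<close>

lemma selector_cong:
  assumes "\<And>i. i < 2 * k \<Longrightarrow> x i = y i"
  shows "selector k F x = selector k F y"
proof -
  have "agree k x = agree k y" unfolding agree_def using assms by auto
  moreover have "prod x {..<k} = prod y {..<k}" using assms by (intro prod.cong) auto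
  ultimately show ?thesis unfolding selector_def by simp
qed

lemma agree_flip:
  assumes "i < k"
  shows "agree k (flip i x) = agree k (flip (k + i) x)"
  unfolding agree_def using assms by (auto simp: flip_def)

text \<open>Flipping \<open>x i\<close> and flipping \<open>x (k + i)\<close> have the same effect on \<open>agree k x\<close>, but only the
  first changes the sign of the product, so exactly one of the two changes the value.\<close>

lemma selector_k_function:
  assumes "2 * k \<le> n"
  shows "(\<lambda>x\<in>cube n. selector k F x) \<in> k_functions n k"
proof -
  let ?f = "\<lambda>x\<in>cube n. selector k F x"
  have sub: "{..<k} \<subseteq> {..<n}" using assms by auto
  have "selector k F x \<in> {-1, 1}" if "x \<in> cube n" for x
    using prod_cube_cases[OF that sub] unfolding selector_def by auto
  then have "?f \<in> boolean_functions n"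
    unfolding boolean_functions_def by auto
  moreover have "card {j \<in> {..<n}. ?f x \<noteq> ?f (flip j x)} = k" if x: "x \<in> cube n" for x
  proof -
    \<comment> \<open>\<open>t i\<close> is the one coordinate of the pair \<open>i\<close>,
      \<open>k + i\<close> whose flip changes the value. If flipping \<open>x i\<close> preserves
      membership in \<open>F\<close>, the sign of the product changes alone; otherwise the two
      changes cancel at \<open>i\<close> and the membership change alone is visible at
      \<open>k + i\<close>.\<close>
    define t where
      "t i = (if agree k x \<in> F \<longleftrightarrow> agree k (flip i x) \<in> F then i else k + i)" for i
    have P: "prod x {..<k} \<noteq> 0" using prod_cube_cases[OF x sub] by linarith
    have fx: "?f (flip j x) = selector k F (flip j x)" if "j < n" for j
      using flip_in_cube[OF x that] by simp
    have low: "?f x \<noteq> ?f (flip i x) \<longleftrightarrow> t i = i" if "i < k" for i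
    proof -
      have "?f x \<noteq> ?f (flip i x) \<longleftrightarrow> selector k F x \<noteq> selector k F (flip i x)"
        using x fx[of i] that assms by simp
      also have "\<dots> \<longleftrightarrow> t i = i"
        using P that unfolding selector_def t_def by (simp add: prod_flip)
      finally show ?thesis .
    qed
    have high: "?f x \<noteq> ?f (flip (k + i) x) \<longleftrightarrow> t i = k + i" if "i < k" for i
    proof -
      have "?f x \<noteq> ?f (flip (k + i) x) \<longleftrightarrow> selector k F x \<noteq> selector k F (flip (k + i) x)"
        using x fx[of "k + i"] that assms by simp
      also have "\<dots> \<longleftrightarrow> t i = k + i"
        using P that unfolding selector_def t_def agree_flip[OF that] by (simp add: prod_flip)
      finally show ?thesis .
    qed
    have rest: "?f x = ?f (flip j x)" if "2 * k \<le> j" "j < n" for j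
      using fx[OF that(2)] x selector_cong[of k x "flip j x" F] that by (auto simp: flip_other)
    have "{j \<in> {..<n}. ?f x \<noteq> ?f (flip j x)} = t ` {..<k}"
    proof
      show "{j \<in> {..<n}. ?f x \<noteq> ?f (flip j x)} \<subseteq> t ` {..<k}"
      proof
        fix j assume j: "j \<in> {j \<in> {..<n}. ?f x \<noteq> ?f (flip j x)}"
        then have "j < 2 * k" using rest[of j] by fastforce
        then consider "j < k" | i where "i < k" "j = k + i"
          by (metis add_diff_inverse_nat less_diff_conv2 linorder_not_less mult_2
              nat_add_left_cancel_less)
        then show "j \<in> t ` {..<k}"
        proof cases
          case 1
          then have "t j = j" using low[of j] j by blast
          then show ?thesis using 1 by (metis imageI lessThan_iff)
        next
          case 2
          then have "t i = j" using high[of i] j by blast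
          then show ?thesis using 2 by (metis imageI lessThan_iff)
        qed
      qed
      show "t ` {..<k} \<subseteq> {j \<in> {..<n}. ?f x \<noteq> ?f (flip j x)}"
      proof
        fix j assume "j \<in> t ` {..<k}"
        then obtain i where i: "i < k" "j = t i" by auto
        have "j = i \<or> j = k + i" unfolding i(2) t_def by auto
        then show "j \<in> {j \<in> {..<n}. ?f x \<noteq> ?f (flip j x)}"
        proof
          assume "j = i"
          moreover have "i < n" using i(1) assms by simp
          ultimately show ?thesis using low[OF i(1)] i(2) by simp
        next
          assume "j = k + i"
          moreover have "k + i < n" using i(1) assms by simp
          ultimately show ?thesis using high[OF i(1)] i(2) by simp
        qed
      qed
    qed
    moreover have "inj_on t {..<k}" unfolding t_def inj_on_def by auto
    ultimately show ?thesis by (simp add: card_image)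
  qed
  ultimately show ?thesis unfolding k_functions_iff by auto
qed

text \<open>At this vertex the first \<open>k\<close> coordinates are 1 and \<open>x (k + i)\<close>
  is 1 exactly for \<open>i \<in> S\<close>, so the agreement set is \<open>S\<close> and the
  product is 1. These points read off \<open>F\<close>.\<close>

lemma selector_sign_vec:
  assumes "2 * k \<le> n" "S \<subseteq> {..<k}"
  shows "selector k F (sign_vec n ((+) k ` ({..<k} - S))) = (if S \<in> F then 1 else -1)"
proof -
  let ?A = "(+) k ` ({..<k} - S)"
  have "agree k (sign_vec n ?A) = S"
    unfolding agree_def sign_vec_def using assms by auto
  moreover have "?A \<inter> {..<k} = {}" by auto
  ultimately show ?thesis
    unfolding selector_def using assms(1) by (subst prod_sign_vec) auto
qed

text \<open>An automorphism acts on each of the first \<open>2k\<close> coordinates as a signed coordinate of the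
  argument. On points whose coordinates beyond \<open>2k\<close> are \<open>1\<close>, only \<open>2k + 1\<close> such coordinates are
  distinguishable, which makes the bound independent of \<open>n\<close>.\<close>

lemma card_selector_class_le:
  assumes "2 * k \<le> n"
  shows "card {F \<in> Pow (Pow {..<k}). cube_isomorphic n (\<lambda>x\<in>cube n. selector k F x)
      (\<lambda>x\<in>cube n. selector k F0 x)} \<le> 2 * (2 * (2 * k + 1)) ^ (2 * k)"
    (is "card ?B \<le> _")
proof -
  define y where "y S = sign_vec n ((+) k ` ({..<k} - S))" for S
  \<comment> \<open>A code is the global sign together with a sign and a source for each of the
    first \<open>2 * k\<close> coordinates; the source \<open>2 * k\<close> stands for all indices
    from there on.\<close>
  define C where "C = {-1, 1 :: real} \<times> ({..<2 * k} \<rightarrow>\<^sub>E {-1, 1 :: real} \<times> {..2 * k})"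
  define D where "D = (\<lambda>(\<epsilon>, c). {S \<in> Pow {..<k}.
    \<epsilon> * selector k F0 (\<lambda>i. fst (c i) * y S (snd (c i))) = 1})"
  have finC: "finite C"
    unfolding C_def by (intro finite_cartesian_product finite_PiE) auto
  have "?B \<subseteq> D ` C"
  proof
    fix F assume "F \<in> ?B"
    then have F: "F \<subseteq> Pow {..<k}" and iso: "cube_isomorphic n (\<lambda>x\<in>cube n. selector k F x)
        (\<lambda>x\<in>cube n. selector k F0 x)" by auto
    from iso obtain \<phi> \<epsilon> where p: "cube_automorphism n \<phi>" "\<epsilon> \<in> {-1, 1}"
      "\<And>x. x \<in> cube n \<Longrightarrow> selector k F x = \<epsilon> * (\<lambda>x\<in>cube n. selector k F0 x) (\<phi> x)"
      unfolding cube_isomorphic_def by auto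
    have p3: "selector k F x = \<epsilon> * selector k F0 (\<phi> x)" if "x \<in> cube n" for x
      using p(3)[OF that] automorphism_in_cube[OF p(1) that] by simp
    from automorphism_signed_coordinates[OF p(1)] obtain j s where
      js: "\<forall>i<n. j i < n" "\<forall>i<n. s i \<in> {-1, 1}" "\<forall>i<n. \<forall>x\<in>cube n. \<phi> x i = s i * x (j i)"
      by (elim exE conjE)
    define c where "c = (\<lambda>i\<in>{..<2 * k}. (s i, min (j i) (2 * k)))"
    have "(\<epsilon>, c) \<in> C"
    proof -
      have "(s i, min (j i) (2 * k)) \<in> {-1, 1} \<times> {..2 * k}" if "i \<in> {..<2 * k}" for i
        using js(2)[rule_format, of i] that assms by simp
      then have "c \<in> {..<2 * k} \<rightarrow>\<^sub>E {-1, 1} \<times> {..2 * k}"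
        unfolding c_def restrict_PiE_iff by blast
      then show ?thesis unfolding C_def using p(2) by (rule SigmaI[rotated])
    qed
    moreover have "D (\<epsilon>, c) = F"
    proof -
      have "S \<in> F \<longleftrightarrow> \<epsilon> * selector k F0 (\<lambda>i. fst (c i) * y S (snd (c i))) = 1"
        if S: "S \<subseteq> {..<k}" for S
      proof -
        \<comment> \<open>All entries of \<open>y S\<close> at indices from \<open>2 * k\<close> up
          to \<open>n - 1\<close> are 1, so those sources may be merged. For
          \<open>n = 2 * k\<close> the minimum is just \<open>l\<close>.\<close>
        have ymin: "y S l = y S (min l (2 * k))" if "l < n" for l
          using that unfolding y_def sign_vec_def by (auto simp: min_def)
        have yc: "y S \<in> cube n" unfolding y_def by (rule sign_vec_in_cube)
        have "\<phi> (y S) i = fst (c i) * y S (snd (c i))" if "i < 2 * k" for i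
        proof -
          have "i < n" using that assms by simp
          then have "\<phi> (y S) i = s i * y S (j i)" using js(3) yc by blast
          also have "y S (j i) = y S (min (j i) (2 * k))"
            by (rule ymin) (use js(1) \<open>i < n\<close> in blast)
          finally show ?thesis using that by (simp add: c_def)
        qed
        then have "selector k F0 (\<lambda>i. fst (c i) * y S (snd (c i))) = selector k F0 (\<phi> (y S))"
          by (intro selector_cong) simp
        then have "\<epsilon> * selector k F0 (\<lambda>i. fst (c i) * y S (snd (c i))) = selector k F (y S)"
          using p3[OF yc] by simp
        then show ?thesis
          using selector_sign_vec[OF assms S, of F] unfolding y_def[symmetric] by simp
      qed
      then have "D (\<epsilon>, c) = {S \<in> Pow {..<k}. S \<in> F}"
        unfolding D_def prod.case by (intro Collect_cong conj_cong refl) auto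
      then show ?thesis using F by blast
    qed
    ultimately show "F \<in> D ` C" by blast
  qed
  then have "card ?B \<le> card C"
    using finC by (meson card_image_le card_mono finite_imageI le_trans)
  also have "\<dots> = 2 * (2 * (2 * k + 1)) ^ (2 * k)"
    unfolding C_def by (simp add: card_cartesian_product card_PiE)
  finally show ?thesis .
qed

text \<open>All \<open>2 ^ 2 ^ k\<close> families give \<open>k\<close>-functions, and each
  isomorphism class receives only the bounded number of families just counted.\<close>

lemma G_lower_bound:
  assumes "2 * k \<le> n"
  shows "2 ^ 2 ^ k \<le> G n k * (2 * (2 * (2 * k + 1)) ^ (2 * k))"
proof -
  have "card (Pow (Pow {..<k})) \<le> G n k * (2 * (2 * (2 * k + 1)) ^ (2 * k))"
    unfolding G_def
  proof (rule card_le_card_quotient_mult[OF equiv_iso_rel finite_k_functions,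
        where F = "\<lambda>F. \<lambda>x\<in>cube n. selector k F x"])
    show "card {F' \<in> Pow (Pow {..<k}). ((\<lambda>x\<in>cube n. selector k F' x), (\<lambda>x\<in>cube n. selector k F x))
        \<in> iso_rel n k} \<le> 2 * (2 * (2 * k + 1)) ^ (2 * k)" for F
      using card_selector_class_le[OF assms, of F] selector_k_function[OF assms]
      by (simp add: iso_rel_def)
  qed (use selector_k_function[OF assms] in auto)
  then show ?thesis by (simp add: card_Pow)
qed

section \<open>Two classes for every \<open>k\<close> from 2 on\<close>

text \<open>A function isomorphic to a character is a signed product of coordinates, hence
  multiplicative, up to one constant sign, in the set of negated coordinates. The selector of the
  single full agreement set violates this.\<close>

lemma not_cube_isomorphic_selector_walsh:
  assumes "2 \<le> k" "2 * k \<le> n"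
  shows "\<not> cube_isomorphic n (\<lambda>x\<in>cube n. selector k {{..<k}} x) (walsh n {..<k})"
proof
  let ?f = "selector k {{..<k}}"
  assume "cube_isomorphic n (\<lambda>x\<in>cube n. ?f x) (walsh n {..<k})"
  then obtain \<phi> \<epsilon> where p: "cube_automorphism n \<phi>" "\<epsilon> \<in> {-1, 1}"
    "\<And>x. x \<in> cube n \<Longrightarrow> ?f x = \<epsilon> * walsh n {..<k} (\<phi> x)"
    unfolding cube_isomorphic_def by auto
  have p3: "?f x = \<epsilon> * prod (\<phi> x) {..<k}" if "x \<in> cube n" for x
    using p(3)[OF that] automorphism_in_cube[OF p(1) that] unfolding walsh_def by simp
  from automorphism_signed_coordinates[OF p(1)] obtain j s where
    js: "\<forall>i<n. j i < n" "\<forall>i<n. s i \<in> {-1, 1}" "\<forall>i<n. \<forall>x\<in>cube n. \<phi> x i = s i * x (j i)"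
    by (elim exE conjE)
  have e: "?f (sign_vec n A) = \<epsilon> * prod s {..<k} * (\<Prod>i<k. sign_vec n A (j i))" for A
  proof -
    have "prod (\<phi> (sign_vec n A)) {..<k} = (\<Prod>i<k. s i * sign_vec n A (j i))"
      using js(3) sign_vec_in_cube[of n A] assms by (intro prod.cong) auto
    then show ?thesis using p3[OF sign_vec_in_cube] by (simp add: prod.distrib)
  qed
  have one: "(\<Prod>i<k. sign_vec n {} (j i)) = 1"
    using js(1) assms by (intro prod.neutral) (auto simp: sign_vec_def)
  have "(\<Prod>i<k. sign_vec n {1, k} (j i)) = (\<Prod>i<k. sign_vec n {1} (j i) * sign_vec n {k} (j i))"
    using js(1) assms by (intro prod.cong) (auto simp: sign_vec_def)
  also have "\<dots> = (\<Prod>i<k. sign_vec n {1} (j i)) * (\<Prod>i<k. sign_vec n {k} (j i))"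
    by (rule prod.distrib)
  finally have both: "(\<Prod>i<k. sign_vec n {1, k} (j i))
      = (\<Prod>i<k. sign_vec n {1} (j i)) * (\<Prod>i<k. sign_vec n {k} (j i))" .
  \<comment> \<open>The indices 1 and \<open>k\<close> lie in different pairs, \<open>1\<close>,
    \<open>k + 1\<close> and \<open>0\<close>, \<open>k\<close>. Every nonempty subset of
    \<open>{1, k}\<close> therefore destroys full agreement, while only 1 affects the product. The
    four values are 1, 1, 1 and -1, in the order of the equation.\<close>
  have mult: "?f (sign_vec n {}) * ?f (sign_vec n {1, k})
      = ?f (sign_vec n {1}) * ?f (sign_vec n {k})"
    unfolding e one both by (simp only: mult_ac mult_1_left mult_1_right)
  have v: "?f (sign_vec n A) = (if agree k (sign_vec n A) = {..<k} then 1 else -1)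
      * (-1) ^ card (A \<inter> {..<k})" for A
    unfolding selector_def using assms prod_sign_vec[of "{..<k}" n A] by simp
  have "agree k (sign_vec n {}) = {..<k}"
    using assms unfolding agree_def sign_vec_def by auto
  then have v0: "?f (sign_vec n {}) = 1" unfolding v by simp
  have neq: "?f (sign_vec n A) = - ((-1) ^ card (A \<inter> {..<k}))"
    if "i \<notin> agree k (sign_vec n A)" "i < k" for A i
  proof -
    have "agree k (sign_vec n A) \<noteq> {..<k}" using that by blast
    then show ?thesis unfolding v by simp
  qed
  have "{1, k} \<inter> {..<k} = {1}" "{1} \<inter> {..<k} = {1}" "{k} \<inter> {..<k} = {}"
    using assms by auto
  moreover have "1 \<notin> agree k (sign_vec n {1, k})" "1 \<notin> agree k (sign_vec n {1})"
    "0 \<notin> agree k (sign_vec n {k})"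
    using assms unfolding agree_def sign_vec_def by auto
  ultimately have "?f (sign_vec n {1, k}) = 1" "?f (sign_vec n {1}) = 1" "?f (sign_vec n {k}) = -1"
    using neq[of 1 "{1, k}"] neq[of 1 "{1}"] neq[of 0 "{k}"] assms by simp_all
  then show False using mult v0 by simp
qed

text \<open>Covers those \<open>m \<ge> 2\<close> for which the counting bound is too weak: the
  exponent in the lower bound is truncated below at 1, and then two classes are enough.\<close>

lemma G_ge_2:
  assumes "2 \<le> k" "2 * k \<le> n"
  shows "2 \<le> G n k"
proof -
  let ?r = "iso_rel n k" and ?f = "\<lambda>x\<in>cube n. selector k {{..<k}} x"
  let ?w = "walsh n {..<k}"
  have f: "?f \<in> k_functions n k" by (rule selector_k_function[OF assms(2)])
  have w: "?w \<in> k_functions n k" using walsh_k_function[of "{..<k}" n] assms by auto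
  have "(?f, ?w) \<notin> ?r"
    using not_cube_isomorphic_selector_walsh[OF assms] unfolding iso_rel_def by auto
  then have "?r `` {?f} \<noteq> ?r `` {?w}"
    using eq_equiv_class[OF _ equiv_iso_rel w] by blast
  then have "card {?r `` {?f}, ?r `` {?w}} = 2" by simp
  moreover have "{?r `` {?f}, ?r `` {?w}} \<subseteq> k_functions n k // ?r"
    using f w by (auto intro: quotientI)
  moreover have "finite (k_functions n k // ?r)"
    using equiv_iso_rel by (meson equiv_type finite_k_functions finite_quotient)
  ultimately show ?thesis unfolding G_def by (metis card_mono)
qed

section \<open>The asymptotic bounds\<close>

text \<open>The subtracted logarithm is of order \<open>m log m\<close>, negligible against
  \<open>2 ^ m\<close>. Eventually the maximum is its second argument, and factoring out
  \<open>2 ^ m\<close> cancels \<open>real m\<close>.\<close>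

lemma lower_exponent_tendsto:
  "(\<lambda>m. log 2 (max 1 (2 ^ m - log 2 (2 * (2 * (2 * real m + 1)) ^ (2 * m)))) - real m)
    \<longlonglongrightarrow> 0"
proof -
  have e: "log 2 (2 * (2 * (2 * real m + 1)) ^ (2 * m))
      = 1 + 2 * real m * log 2 (2 * (2 * real m + 1))" for m
    by (subst log_mult) (simp_all add: log_nat_power)
  let ?r = "\<lambda>m. 1 + 2 * real m * log 2 (2 * (2 * real m + 1))"
  have "(\<lambda>m. log 2 (1 - ?r m / 2 ^ m)) \<longlonglongrightarrow> 0"
    by real_asymp
  moreover have "\<forall>\<^sub>F m in sequentially. 1 < 2 ^ m - ?r m"
    by real_asymp
  then have "\<forall>\<^sub>F m in sequentially.
      log 2 (1 - ?r m / 2 ^ m) = log 2 (max 1 (2 ^ m - ?r m)) - real m"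
  proof eventually_elim
    case (elim m)
    have "1 - ?r m / 2 ^ m = (2 ^ m - ?r m) / 2 ^ m"
      by (simp add: diff_divide_distrib)
    then show ?case
      using elim by (simp only: log_divide) (simp add: max_def log_nat_power)
  qed
  ultimately show ?thesis
    unfolding e by (rule Lim_transform_eventually)
qed

text \<open>The inner logarithm is \<open>4 ^ m\<close> times a quantity of polynomial size. The
  first factor contributes exactly \<open>2 * m\<close> to the outer logarithm, the second a
  multiple of \<open>log 2 m\<close>.\<close>

lemma upper_exponent_bigo:
  "(\<lambda>m. log 2 (log 2 (real (((m * 4 ^ m) ^ m * (2 ^ (m + 1) + 1)) ^ (4 ^ m)))) - 2 * real m)
    \<in> O(\<lambda>m. log 2 (real m))"
proof -
  let ?g = "\<lambda>m::nat. log 2 (real m * (log 2 (real m) + 2 * real m) + log 2 (2 ^ (m + 1) + 1))"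
  have "\<forall>\<^sub>F m in sequentially.
    log 2 (log 2 (real (((m * 4 ^ m) ^ m * (2 ^ (m + 1) + 1)) ^ (4 ^ m)))) - 2 * real m = ?g m"
    using eventually_gt_at_top[of 0]
  proof eventually_elim
    case (elim m)
    have l4: "log 2 (4 ^ m) = 2 * real m"
      using log_nat_power[of 4 2 m] log_nat_power[of 2 2 2] by simp
    have p1: "0 < log 2 (2 ^ (m + 1) + 1 :: real)"
      by (subst zero_less_log_cancel_iff) (auto intro: add_pos_pos)
    have pos: "0 < real m * (log 2 (real m) + 2 * real m) + log 2 (2 ^ (m + 1) + 1)"
      by (intro add_nonneg_pos mult_nonneg_nonneg add_nonneg_nonneg p1) (use elim in auto)
    have q: "0 < (2 ^ (m + 1) + 1 :: real)" by (simp add: add_pos_pos)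
    have r: "0 < (real m * 4 ^ m) ^ m" using elim by simp
    have "log 2 (real (((m * 4 ^ m) ^ m * (2 ^ (m + 1) + 1)) ^ (4 ^ m)))
        = log 2 (((real m * 4 ^ m) ^ m * (2 ^ (m + 1) + 1)) ^ (4 ^ m))"
      by (simp add: algebra_simps)
    also have "\<dots> = 4 ^ m * log 2 ((real m * 4 ^ m) ^ m * (2 ^ (m + 1) + 1))"
      by (subst log_nat_power) (use q r in auto)
    also have "log 2 ((real m * 4 ^ m) ^ m * (2 ^ (m + 1) + 1))
        = real m * log 2 (real m * 4 ^ m) + log 2 (2 ^ (m + 1) + 1)"
      using q r elim by (subst log_mult) (auto simp: log_nat_power)
    also have "log 2 (real m * 4 ^ m) = log 2 (real m) + 2 * real m"
      using elim l4 by (simp add: log_mult)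
    finally have "log 2 (log 2 (real (((m * 4 ^ m) ^ m * (2 ^ (m + 1) + 1)) ^ (4 ^ m))))
        = log 2 (4 ^ m) + ?g m"
      using pos by (simp only: log_mult) simp
    then show ?case using l4 by simp
  qed
  moreover have "?g \<in> O(\<lambda>m. log 2 (real m))"
  proof (rule bigoI)
    \<comment> \<open>The left side grows quadratically; the power on the right becomes the constant
      4 of the bound.\<close>
    have "\<forall>\<^sub>F m in sequentially. real m * (log 2 (real m) + 2 * real m) + (real m + 2) \<le> real m ^ 4"
      by real_asymp
    then show "\<forall>\<^sub>F m in sequentially. norm (?g m) \<le> 4 * norm (log 2 (real m))"
      using eventually_gt_at_top[of 0]
    proof eventually_elim
      case (elim m)
      have ge: "1 \<le> (2::real) ^ (m + 1)" by (rule one_le_power) simp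
      then have "(2::real) ^ (m + 1) + 1 \<le> 2 * 2 ^ (m + 1)" by linarith
      also have "\<dots> = 2 ^ (m + 2)" by simp
      finally have "log 2 ((2::real) ^ (m + 1) + 1) \<le> log 2 (2 ^ (m + 2))"
        using ge by (subst log_le_cancel_iff) linarith+
      also have "\<dots> = real (m + 2)" by (simp only: log_pow_cancel)
      finally have up: "log 2 ((2::real) ^ (m + 1) + 1) \<le> real m + 2" by simp
      have "log 2 2 \<le> log 2 ((2::real) ^ (m + 1) + 1)"
        using ge by (subst log_le_cancel_iff) linarith+
      then have low: "1 \<le> log 2 ((2::real) ^ (m + 1) + 1)" by simp
      have "0 \<le> real m * (log 2 (real m) + 2 * real m)"
        using elim(2) by (intro mult_nonneg_nonneg add_nonneg_nonneg) auto
      then have one: "1 \<le> real m * (log 2 (real m) + 2 * real m) + log 2 (2 ^ (m + 1) + 1)"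
        using low by linarith
      have "?g m \<le> log 2 (real m ^ 4)"
        using one elim up by (subst log_le_cancel_iff) auto
      also have "\<dots> = 4 * log 2 (real m)" using elim(2) by (simp add: log_nat_power)
      finally show ?case using one elim(2) by simp
    qed
  qed
  ultimately show ?thesis
    by (simp add: landau_o.big.in_cong)
qed

theorem theorem1:
  shows "\<exists>a b :: nat \<Rightarrow> real.
    a \<longlonglongrightarrow> 0 \<and>
    b \<in> O(\<lambda>m. log 2 (real m)) \<and>
    (\<forall>n k m :: nat. k \<le> n \<and> m = min k (n - k) \<longrightarrow>
       (m \<ge> 2 \<longrightarrow> 2 powr (2 powr (real m + a m)) \<le> real (G n k)) \<and>
       real (G n k) \<le> 2 powr (2 powr (2 * real m + b m)))"
proof -
  define M where "M m = 2 * (2 * (2 * real m + 1)) ^ (2 * m)" for m :: nat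
  define U where "U m = ((m * 4 ^ m) ^ m * (2 ^ (m + 1) + 1)) ^ (4 ^ m)" for m :: nat
  \<comment> \<open>\<open>a\<close> and \<open>b\<close> are chosen so that the double exponentials
    collapse to \<open>2 powr max 1 (2 ^ m - log 2 (M m))\<close> and to \<open>U m\<close>.\<close>
  define a where "a m = log 2 (max 1 (2 ^ m - log 2 (M m))) - real m" for m
  define b where "b m = log 2 (log 2 (real (U m))) - 2 * real m" for m
  have "a \<longlonglongrightarrow> 0"
    unfolding a_def M_def by (rule lower_exponent_tendsto)
  moreover have "b \<in> O(\<lambda>m. log 2 (real m))"
    unfolding b_def U_def by (rule upper_exponent_bigo)
  moreover have "2 powr (2 powr (real m + a m)) \<le> real (G n k)"
    if "k \<le> n" "m = min k (n - k)" "2 \<le> m" for n k m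
  proof -
    have mn: "2 * m \<le> n" and Gm: "G n k = G n m" using that G_min[OF that(1)] by simp_all
    have M0: "0 < M m" unfolding M_def by simp
    have "2 powr (2 powr (real m + a m)) = 2 powr (max 1 (2 ^ m - log 2 (M m)))"
      unfolding a_def by simp
    also have "\<dots> \<le> real (G n m)"
    proof (cases "1 \<le> 2 ^ m - log 2 (M m)")
      case True
      have "real (2 ^ 2 ^ m) \<le> real (G n m * (2 * (2 * (2 * m + 1)) ^ (2 * m)))"
        using G_lower_bound[OF mn] by (simp only: of_nat_le_iff)
      also have "\<dots> = real (G n m) * M m" unfolding M_def by (simp add: add.commute)
      finally have "2 ^ 2 ^ m / M m \<le> real (G n m)" using M0 by (simp add: field_simps)
      moreover have "2 powr (2 ^ m - log 2 (M m)) = 2 ^ 2 ^ m / M m"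
        using M0 by (simp add: powr_diff flip: powr_realpow)
      ultimately show ?thesis using True by (simp add: max_def)
    next
      case False
      then show ?thesis using G_ge_2[OF that(3) mn] by (simp add: max_def)
    qed
    finally show ?thesis using Gm by simp
  qed
  moreover have "real (G n k) \<le> 2 powr (2 powr (2 * real m + b m))"
    if "k \<le> n" "m = min k (n - k)" for n k m
  proof -
    \<comment> \<open>For \<open>m = 0\<close> this is \<open>0 ^ 0 = 1\<close>. The resulting bound
      \<open>2 \<le> U m\<close> makes \<open>log 2 (U m)\<close> positive, so the outer logarithm
      can be inverted.\<close>
    have "1 \<le> (m * 4 ^ m) ^ m" by (cases "m = 0") auto
    moreover have "2 \<le> 2 ^ (m + 1) + (1::nat)" by simp
    ultimately have "1 * 2 \<le> (m * 4 ^ m) ^ m * (2 ^ (m + 1) + 1)" by (rule mult_le_mono)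
    then have U2: "2 \<le> U m"
      unfolding U_def by (intro order_trans[OF _ self_le_power]) auto
    have "2 powr (2 powr (2 * real m + b m)) = real (U m)"
      unfolding b_def using U2 by simp
    moreover have "G n k \<le> U m"
      using G_upper_bound[of n m] G_min[OF that(1)] that(2) unfolding U_def by simp
    ultimately show ?thesis by simp
  qed
  ultimately show ?thesis by blast
qed

end
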